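(* For every real $\tau<3+\frac{15\ln 2}{24}$ there exists an (effectively computable) constant $c>0$ such that for every $N_0\in\mathbb{N}$ there exist infinitely many cubic irrationals $\xi\in\mathbb{R}$ for which the inequality $$\|q\xi\|<\frac{1}{H(\xi)^{\tau}\,q\,e^{c\sqrt{\ln q}}}$$ has more than $N_0$ solutions $q\in\mathbb{N}$.
   Context: A cubic irrational is a real algebraic number of degree $3$. For an algebraic number $\xi$, $H(\xi)$ is its naive height: the maximum of the absolute values of the coefficients of its minimal polynomial over $\mathbb{Z}$ with coprime integer coefficients. $\|y\|$ denotes the distance from $y\in\mathbb{R}$ to the nearest integer. *)

theory Defs
  imports
    Complex_Main
    "HOL-Computational_Algebra.Computational_Algebra"
    "HOL-Library.Nat_Bijection"
begin

section \<open>Algebraic numbers and heights\<close>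

text \<open>
  The minimal polynomial over the integers: a nonzero integer polynomial of least degree vanishing
  at \<open>x\<close>, with coprime coefficients. The sign, which is irrelevant for degree and height,
  is fixed by requiring a positive leading coefficient.
\<close>

definition is_min_int_poly :: "real \<Rightarrow> int poly \<Rightarrow> bool" where
  "is_min_int_poly x P \<longleftrightarrow>
     P \<noteq> 0 \<and> poly (map_poly of_int P) x = 0 \<and>
     (\<forall>Q. Q \<noteq> 0 \<longrightarrow> poly (map_poly of_int Q) x = 0 \<longrightarrow> degree P \<le> degree Q) \<and>
     content P = 1 \<and> lead_coeff P > 0"

definition min_int_poly :: "real \<Rightarrow> int poly" where
  "min_int_poly x = (THE P. is_min_int_poly x P)"

lemma poly_of_int_smult:
  "poly (map_poly of_int (smult a P)) (x::real) = of_int a * poly (map_poly of_int P) x"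
proof -
  have "map_poly of_int (smult a P) = smult (of_int a :: real) (map_poly of_int P)"
    by (rule poly_eqI) (simp add: coeff_map_poly)
  then show ?thesis by simp
qed

lemma poly_of_int_diff:
  "poly (map_poly of_int (P - Q)) (x::real)
     = poly (map_poly of_int P) x - poly (map_poly of_int Q) x"
proof -
  have "map_poly of_int (P - Q) = (map_poly of_int P - map_poly of_int Q :: real poly)"
    by (rule poly_eqI) (simp add: coeff_map_poly)
  then show ?thesis by simp
qed

lemma ex1_min_int_poly:
  assumes "algebraic x"
  shows "\<exists>!P. is_min_int_poly x P"
proof (rule ex_ex1I)
  define V where "V = (\<lambda>P::int poly. P \<noteq> 0 \<and> poly (map_poly of_int P) x = 0)"
  from assms obtain P0 where "V P0"
    unfolding V_def by (elim algebraicE') auto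
  define P where "P = arg_min degree V"
  have P: "V P" "\<And>Q. V Q \<Longrightarrow> degree P \<le> degree Q"
    using arg_min_natI[of V P0 degree] arg_min_nat_le[of V _ degree] \<open>V P0\<close>
    by (auto simp: P_def)
  define s where "s = sgn (lead_coeff P)"
  define R where "R = smult s (primitive_part P)"
  have P0: "P \<noteq> 0" using P by (auto simp: V_def)
  have s: "s = 1 \<or> s = -1" using P0 by (auto simp: s_def sgn_if)
  have eq: "P = smult (s * content P) R"
    using s by (auto simp: R_def)
  have c: "content P > 0"
    using P0 by (metis abs_ge_zero content_eq_zero_iff normalize_content normalize_int_def
        order_less_le)
  have "lead_coeff P = s * content P * lead_coeff R"
    using arg_cong[OF eq, of lead_coeff] s by (auto simp: lead_coeff_smult R_def)
  moreover have "lead_coeff P = s * \<bar>lead_coeff P\<bar>" by (simp add: s_def mult.commute abs_mult_sgn)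
  ultimately have "content P * lead_coeff R = \<bar>lead_coeff P\<bar>"
    using s by auto
  then have lc: "lead_coeff R > 0"
    using c P0 by (metis leading_coeff_0_iff zero_less_abs_iff zero_less_mult_pos)
  have "content R = 1"
    using s P0 by (auto simp: R_def content_primitive_part)
  moreover have "poly (map_poly of_int R) x = 0"
  proof -
    have "of_int (s * content P) * poly (map_poly of_int R) x = 0"
      using P(1) eq poly_of_int_smult[of "s * content P" R x] by (simp add: V_def)
    then show ?thesis using s c by auto
  qed
  moreover have "degree R = degree P"
    using s by (auto simp: R_def)
  ultimately have "is_min_int_poly x R"
    using P lc by (auto simp: is_min_int_poly_def V_def)
  then show "\<exists>P. is_min_int_poly x P" ..
next
  fix P Q assume PQ: "is_min_int_poly x P" "is_min_int_poly x Q"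
  have deg: "degree P = degree Q"
    using PQ by (auto simp: is_min_int_poly_def intro: antisym)
  define R where "R = smult (lead_coeff Q) P - smult (lead_coeff P) Q"
  have root: "poly (map_poly of_int R) x = 0"
    using PQ by (simp add: R_def poly_of_int_diff poly_of_int_smult is_min_int_poly_def)
  have "R = 0"
  proof (rule ccontr)
    assume "R \<noteq> 0"
    then have le: "degree P \<le> degree R" using PQ root by (auto simp: is_min_int_poly_def)
    moreover have "degree R \<le> degree P"
      unfolding R_def using deg by (intro degree_diff_le) auto
    ultimately have "lead_coeff R = coeff R (degree P)" by simp
    also have "\<dots> = 0" using deg by (simp add: R_def)
    finally show False using \<open>R \<noteq> 0\<close> by simp
  qed
  then have eq: "smult (lead_coeff Q) P = smult (lead_coeff P) Q" by (simp add: R_def)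
  then have "content (smult (lead_coeff Q) P) = content (smult (lead_coeff P) Q)" by simp
  then have "lead_coeff Q = lead_coeff P"
    using PQ by (simp add: is_min_int_poly_def)
  then have "smult (lead_coeff P) (P - Q) = 0" using eq by (simp add: smult_diff_right)
  then show "P = Q" using PQ by (simp add: is_min_int_poly_def)
qed

definition cubic_irrational :: "real \<Rightarrow> bool" where
  "cubic_irrational x \<longleftrightarrow> algebraic x \<and> degree (min_int_poly x) = 3"

definition naive_height :: "real \<Rightarrow> int" where
  "naive_height x = (MAX i\<in>{..degree (min_int_poly x)}. \<bar>coeff (min_int_poly x) i\<bar>)"

definition dist_nearest_int :: "real \<Rightarrow> real" where
  "dist_nearest_int y = \<bar>y - of_int (round y)\<bar>"


section \<open>Effective computability of a real constant from a real parameter\<close>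

text \<open>
  Partial recursive functions with a function oracle \<open>\<phi>\<close>; \<open>computes \<phi> f xs y\<close> means that
  the program \<open>f\<close>, run with oracle \<open>\<phi>\<close> on the arguments \<open>xs\<close>, halts with output \<open>y\<close>.
\<close>

datatype recf =
  Zero | Succ | Proj nat | Oracle | Comp recf "recf list" | PrimRec recf recf | Mu recf

inductive computes :: "(nat \<Rightarrow> nat) \<Rightarrow> recf \<Rightarrow> nat list \<Rightarrow> nat \<Rightarrow> bool" for \<phi> where
  zero: "computes \<phi> Zero xs 0"
| succ: "computes \<phi> Succ [x] (Suc x)"
| proj: "i < length xs \<Longrightarrow> computes \<phi> (Proj i) xs (xs ! i)"
| orac: "computes \<phi> Oracle [x] (\<phi> x)"
| comp: "list_all2 (\<lambda>g y. computes \<phi> g xs y) gs ys \<Longrightarrow> computes \<phi> f ys z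
           \<Longrightarrow> computes \<phi> (Comp f gs) xs z"
| prec_0: "computes \<phi> f xs y \<Longrightarrow> computes \<phi> (PrimRec f g) (0 # xs) y"
| prec_Suc: "computes \<phi> (PrimRec f g) (n # xs) y \<Longrightarrow> computes \<phi> g (n # y # xs) z
           \<Longrightarrow> computes \<phi> (PrimRec f g) (Suc n # xs) z"
| mu: "computes \<phi> f (n # xs) 0 \<Longrightarrow> (\<forall>m<n. \<exists>y. computes \<phi> f (m # xs) (Suc y))
           \<Longrightarrow> computes \<phi> (Mu f) xs n"

text \<open>
  A name of a real number lists (integer codes of) numerators of rational approximations:
  the \<open>n\<close>-th entry gives a fraction with denominator \<open>n + 1\<close> and error at most \<open>1 / (n + 1)\<close>.
\<close>

definition is_name :: "(nat \<Rightarrow> nat) \<Rightarrow> real \<Rightarrow> bool" where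
  "is_name \<phi> x \<longleftrightarrow>
     (\<forall>n. \<bar>x - of_int (int_decode (\<phi> n)) / (real n + 1)\<bar> \<le> 1 / (real n + 1))"

text \<open>
  The program \<open>p\<close> computes \<open>c\<close> from \<open>t\<close>: given any name of \<open>t\<close> as oracle, it computes a name
  of \<open>c\<close>.
\<close>

definition computes_real :: "recf \<Rightarrow> real \<Rightarrow> real \<Rightarrow> bool" where
  "computes_real p t c \<longleftrightarrow>
     (\<forall>\<phi>. is_name \<phi> t \<longrightarrow> (\<exists>\<psi>. is_name \<psi> c \<and> (\<forall>n. computes \<phi> p [n] (\<psi> n))))"

end

theory Submission
  imports Defs "HOL-Real_Asymp.Real_Asymp"
begin

text \<open>
  For a solution of the Pell equation \<open>u\<^sup>2 - 5 v\<^sup>2 = 1\<close> consider the cubic form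
  \<open>F(X, Y) = 10 (3u - 5v) X\<^sup>3 - 30 v X Y\<^sup>2 - (3u + v) Y\<^sup>3\<close>, whose height is at most \<open>30 v\<close>.
  It is irreducible (Eisenstein at 2), and it takes the bounded value \<open>-135\<close> at a point \<open>(p, q)\<close>
  whose coordinates are cubic polynomials in \<open>u, v\<close>. Hence the root \<open>\<xi>\<close> of \<open>F(x, 1)\<close> near
  \<open>p / q\<close> satisfies \<open>q \<parallel>q \<xi>\<parallel> = O(v^(-4)) = O(H(\<xi>)^(-4))\<close> with \<open>q = O(v\<^sup>3)\<close>. Since
  \<open>3 + 15 ln 2 / 24 < 4\<close>, the multiples \<open>q, 2q, \<dots>, (N + 1) q\<close> are all solutions once \<open>v\<close> is
  large, and the factor \<open>e^(c sqrt (ln q))\<close> is absorbed, as it is smaller than any power of \<open>v\<close>.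
  So \<open>c = 1\<close> works for every \<open>\<tau>\<close>.

  The form is a reduced model of \<open>x\<^sup>3 - 3 A x + 2 B\<close> for the pairs \<open>(A, B)\<close> with small
  \<open>A\<^sup>3 - B\<^sup>2\<close> that come from Danilov's identity
  \<open>(t\<^sup>2 - 5)\<^sup>2 ((t + 9)\<^sup>2 + 4) - (t\<^sup>2 + 6t - 11)\<^sup>3 = -1728 (t - 2)\<close>.
\<close>

section \<open>Minimal polynomials and Eisenstein cubics\<close>

lemma is_min_int_poly_min_int_poly:
  assumes "algebraic x"
  shows "is_min_int_poly x (min_int_poly x)"
  unfolding min_int_poly_def by (rule theI'[OF ex1_min_int_poly[OF assms]])

text \<open>The pseudo-remainder of \<open>F\<close> by the minimal polynomial vanishes at
  \<open>x\<close>, so minimality of the degree forces it to be 0. Gauss's lemma, through primitive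
  parts, then removes the scalar \<open>a\<close>.\<close>

lemma min_int_poly_dvd:
  assumes "algebraic x" and root: "poly (map_poly of_int F) x = 0"
  shows "min_int_poly x dvd F"
proof -
  define M where "M = min_int_poly x"
  have M: "is_min_int_poly x M"
    unfolding M_def by (rule is_min_int_poly_min_int_poly[OF assms(1)])
  then have M0: "M \<noteq> 0" and cM: "content M = 1"
    by (auto simp: is_min_int_poly_def)
  define R where "R = pseudo_mod F M"
  obtain a G where a: "a \<noteq> 0" and eq: "smult a F = M * G + R"
    using pseudo_mod(1)[OF M0, of F] unfolding R_def by blast
  have hom: "(map_poly of_int (M * G) :: real poly) = map_poly of_int M * map_poly of_int G"
    by (rule poly_eqI) (simp add: coeff_map_poly coeff_mult)
  have "R = smult a F - M * G" using eq by simp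
  then have "poly (map_poly of_int R) x = 0"
    using root M by (simp add: poly_of_int_diff poly_of_int_smult hom is_min_int_poly_def)
  then have "R = 0"
    using M pseudo_mod(2)[OF M0, of F] unfolding is_min_int_poly_def R_def
    by (meson not_le)
  then have "primitive_part (smult a F) = primitive_part M * primitive_part G"
    using eq by (simp add: primitive_part_mult)
  then have "M dvd smult (unit_factor a) (primitive_part F)"
    using cM by (simp add: primitive_part_smult primitive_part_prim)
  moreover have "unit_factor a = 1 \<or> unit_factor a = - 1"
    using a by (simp add: sgn_if)
  ultimately have "M dvd primitive_part F"
    by (auto simp: dvd_minus_iff)
  then show ?thesis
    unfolding M_def[symmetric] by (metis content_times_primitive_part dvd_smult)
qed

text \<open>Eisenstein at 2 for the reversed polynomial. Both \<open>b\<close> and \<open>g0\<close>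
  are odd. If \<open>a\<close> is even, \<open>c2\<close> makes \<open>g2\<close> even and 4 divides
  \<open>c3\<close>; if \<open>a\<close> is odd, \<open>g2\<close> is even, \<open>c1\<close> makes
  \<open>g1\<close> odd, and \<open>c2\<close> would be odd.\<close>

lemma eisenstein_2_no_linear_factor:
  fixes L G :: "int poly"
  assumes "L * G = [:c0, c1, c2, c3:]" and "odd c0" "even c1" "even c2" "even c3" "\<not> 4 dvd c3"
    and "degree L = 1" "degree G = 2"
  shows False
proof -
  define b a where "b = coeff L 0" and "a = coeff L 1"
  define g0 g1 g2 where "g0 = coeff G 0" and "g1 = coeff G 1" and "g2 = coeff G 2"
  have L: "L = [:b, a:]"
    using assms(7) by (intro poly_eqI)
      (auto simp: a_def b_def coeff_pCons coeff_eq_0 numeral_2_eq_2 split: nat.split)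
  have G: "G = [:g0, g1, g2:]"
    using assms(8) by (intro poly_eqI)
      (auto simp: g0_def g1_def g2_def coeff_pCons coeff_eq_0 numeral_2_eq_2 split: nat.split)
  have "c0 = b * g0" "c1 = b * g1 + a * g0" "c2 = b * g2 + a * g1" "c3 = a * g2"
    using assms(1) unfolding L G by (auto simp: algebra_simps)
  moreover have "4 dvd a * g2" if "even a" "even g2"
    using that by (auto elim!: evenE)
  ultimately show False
    using assms(2-6) by (cases "even a") auto
qed

text \<open>The minimal polynomial divides \<open>F\<close>, and the criterion rules out degrees 1
  and 2. The cofactor is thus a nonzero integer, so passing from \<open>F\<close> to the minimal
  polynomial cannot enlarge a coefficient.\<close>

lemma cubic_irrationalI:
  fixes x :: real
  assumes F: "F = [:c0, c1, c2, c3:]" and root: "poly (map_poly of_int F) x = 0"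
    and par: "odd c0" "even c1" "even c2" "even c3" "\<not> 4 dvd c3"
  shows "cubic_irrational x"
    and "1 \<le> naive_height x"
    and "\<And>B. (\<And>i. \<bar>coeff F i\<bar> \<le> B) \<Longrightarrow> naive_height x \<le> B"
proof -
  have c3: "c3 \<noteq> 0" using par by auto
  have F0: "F \<noteq> 0" and dF: "degree F = 3" using F c3 by auto
  have alg: "algebraic x"
    using F0 root by (intro algebraicI'[of "map_poly of_int F"])
      (auto simp: coeff_map_poly map_poly_eq_0_iff)
  define M where "M = min_int_poly x"
  have M: "is_min_int_poly x M"
    unfolding M_def by (rule is_min_int_poly_min_int_poly[OF alg])
  then have M0: "M \<noteq> 0" by (simp add: is_min_int_poly_def)
  obtain G where G: "F = M * G"
    using min_int_poly_dvd[OF alg root] unfolding M_def by blast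
  then have G0: "G \<noteq> 0" using F0 by auto
  have deg: "degree M + degree G = 3"
    using G M0 G0 dF by (simp add: degree_mult_eq)
  have "degree M \<noteq> 0"
  proof
    assume "degree M = 0"
    then obtain m where "M = [:m:]" by (rule degree_eq_zeroE)
    then show False using M by (auto simp: is_min_int_poly_def map_poly_pCons)
  qed
  moreover have "degree M \<noteq> 1"
    using eisenstein_2_no_linear_factor[OF _ par, of M G] G F deg by auto
  moreover have "degree M \<noteq> 2"
    using eisenstein_2_no_linear_factor[OF _ par, of G M] G F deg by (auto simp: mult.commute)
  ultimately have dM: "degree M = 3" using deg by linarith
  then show "cubic_irrational x" using alg by (simp add: cubic_irrational_def M_def)
  have ht: "naive_height x = Max ((\<lambda>i. \<bar>coeff M i\<bar>) ` {..3})"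
    unfolding naive_height_def M_def[symmetric] dM ..
  have "coeff M 3 > 0" using M dM by (simp add: is_min_int_poly_def)
  then show "1 \<le> naive_height x"
    unfolding ht by (subst Max_ge_iff) (auto intro!: bexI[of _ 3])
  have "degree G = 0" using dM deg by simp
  then obtain g where g: "G = [:g:]" by (rule degree_eq_zeroE)
  then have "g \<noteq> 0" using G0 by auto
  have "\<bar>coeff M i\<bar> \<le> \<bar>coeff F i\<bar>" for i
    using mult_left_mono[of 1 "\<bar>g\<bar>" "\<bar>coeff M i\<bar>"] \<open>g \<noteq> 0\<close>
    unfolding G g by (simp add: abs_mult mult.commute)
  then show "naive_height x \<le> B" if "\<And>i. \<bar>coeff F i\<bar> \<le> B" for B
    unfolding ht using that by (subst Max_le_iff) (auto intro: order_trans)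
qed

section \<open>Solutions of the Pell equation\<close>

lemma pell_solution_above:
  "\<exists>u v::int. u\<^sup>2 - 5 * v\<^sup>2 = 1 \<and> u > 0 \<and> v > int n"
proof (induction n)
  case 0
  show ?case by (rule exI[of _ 9], rule exI[of _ 4]) simp
next
  case (Suc n)
  then obtain u v :: int where "u\<^sup>2 - 5 * v\<^sup>2 = 1" "u > 0" "v > int n" by blast
  then show ?case
    \<comment> \<open>Multiplication of u + v sqrt 5 by the unit 9 + 4 sqrt 5 of norm 1.\<close>
    by (intro exI[of _ "9 * u + 20 * v"] exI[of _ "4 * u + 9 * v"])
      (auto simp: power2_eq_square algebra_simps)
qed

text \<open>An odd \<open>v\<close> would give a square congruent to 2 modulo 4. The parities supply
  the Eisenstein conditions: \<open>3 * u + v\<close> and \<open>3 * u - 5 * v\<close> are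
  odd.\<close>

lemma pell_parity:
  fixes u v :: int
  assumes "u\<^sup>2 - 5 * v\<^sup>2 = 1"
  shows "odd u" and "even v"
proof -
  have e: "u\<^sup>2 = 5 * v\<^sup>2 + 1" using assms by simp
  have "even v"
  proof (rule ccontr)
    assume "odd v"
    then obtain w where w: "v = 2 * w + 1" by (elim oddE)
    with e have "even (u\<^sup>2)" by simp
    then obtain z where "u = 2 * z" by (auto elim: evenE)
    with e w have "4 * z\<^sup>2 = 20 * w\<^sup>2 + 20 * w + 6" by (simp add: power2_eq_square algebra_simps)
    then show False by presburger
  qed
  then have "odd (u\<^sup>2)" unfolding e by simp
  then show "odd u" by simp
  show "even v" by fact
qed

section \<open>The cubic attached to a Pell solution\<close>

lemma pell_cubic_identity:
  fixes u v :: "'a::comm_ring_1"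
  defines "p \<equiv> 2 * u\<^sup>2 * (u - 5 * v)"
    and "q \<equiv> 5 * (u ^ 3 - 5 * u\<^sup>2 * v + 15 * u * v\<^sup>2 - 15 * v ^ 3)"
  shows "10 * (3 * u - 5 * v) * p ^ 3 - 30 * v * p * q\<^sup>2 - (3 * u + v) * q ^ 3
    = - 135 * (u\<^sup>2 - 5 * v\<^sup>2) ^ 5"
  unfolding p_def q_def
  by (simp add: power2_eq_square power3_eq_cube eval_nat_numeral algebra_simps)


text \<open>The form has absolute value 135 at (p, q), while its dehomogenization \<open>f\<close>
  has divided differences at least 30v near the root. Hence |\<xi> - p/q| \<le> 135 / (30 v q^3),
  and q \<ge> 18 v^3 turns this into the bound.\<close>

lemma pell_cubic_approximation:
  fixes u v :: int
  assumes pell: "u\<^sup>2 - 5 * v\<^sup>2 = 1" and "u > 0" "v \<ge> 16"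
  obtains \<xi> :: real and p :: int and q :: nat where
    "10 * (3 * of_int u - 5 * of_int v) * \<xi> ^ 3 - 30 * of_int v * \<xi> - (3 * of_int u + of_int v) = 0"
    and "\<xi> < 0" and "q \<ge> 1" and "real q \<le> 30 * of_int v ^ 3"
    and "real q * \<bar>real q * \<xi> - of_int p\<bar> * (4 * of_int v ^ 4) \<le> 1"
proof -
  define U V where "U = real_of_int u" and "V = real_of_int v"
  have V: "V \<ge> 16" using assms by (simp add: V_def)
  have "real_of_int (u\<^sup>2 - 5 * v\<^sup>2) = 1" unfolding pell by simp
  then have UV: "U\<^sup>2 - 5 * V\<^sup>2 = 1" by (simp add: U_def V_def)
  \<comment> \<open>The ratio is close to sqrt 5; \<open>v \<ge> 16\<close> gives 1/v^2 < 0.004,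
    enough to place it between 2.236 and 2.237.\<close>
  define r where "r = U / V"
  have U: "U = r * V" using V by (simp add: r_def)
  have "U > 0" using assms by (simp add: U_def)
  then have r0: "r > 0" using V by (simp add: r_def)
  have "r\<^sup>2 * V\<^sup>2 = 5 * V\<^sup>2 + 1" using UV by (simp add: U power_mult_distrib)
  then have "r\<^sup>2 = 5 + 1 / V\<^sup>2" using V by (simp add: field_simps)
  moreover have "1 / V\<^sup>2 \<le> 1 / 16\<^sup>2"
    using V by (intro divide_left_mono power_mono) auto
  moreover have "1 / V\<^sup>2 \<ge> 0" by simp
  ultimately have r2: "5 \<le> r\<^sup>2" "r\<^sup>2 \<le> 5004 / 1000" by simp_all
  have "(2236 / 1000)\<^sup>2 \<le> (5 :: real)" "5004 / 1000 \<le> (2237 / 1000 :: real)\<^sup>2"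
    by (simp_all add: power2_eq_square)
  then have "(2236 / 1000)\<^sup>2 \<le> r\<^sup>2" "r\<^sup>2 \<le> (2237 / 1000)\<^sup>2"
    using r2 by (blast intro: order_trans)+
  then have rl: "2236 / 1000 \<le> r" and ru: "r \<le> 2237 / 1000"
    using power2_le_imp_le[of "2236 / 1000" r] power2_le_imp_le[of r "2237 / 1000"] r0 by simp_all
  define s where "s = r ^ 3 - 5 * r\<^sup>2 + 15 * r - 15"
  define t where "t = r\<^sup>2 * (5 - r)"
  have r3: "5 * r \<le> r ^ 3" "r ^ 3 \<le> 5004 / 1000 * r"
    using r2 r0 by (simp_all add: power3_eq_cube power2_eq_square mult_right_mono)
  have s: "470 / 100 \<le> s" "s \<le> 480 / 100" using r2 r3 rl ru by (simp_all add: s_def)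
  have "t = 5 * r\<^sup>2 - r ^ 3" by (simp add: t_def algebra_simps power2_eq_square power3_eq_cube)
  then have t: "1380 / 100 \<le> t" "t \<le> 1384 / 100"
    using r2 r3 rl ru by simp_all
  define p where "p = 2 * u\<^sup>2 * (u - 5 * v)"
  define n where "n = 5 * (u ^ 3 - 5 * u\<^sup>2 * v + 15 * u * v\<^sup>2 - 15 * v ^ 3)"
  have p: "real_of_int p = - 2 * t * V ^ 3"
    by (simp add: p_def t_def U V_def[symmetric] U_def[symmetric] algebra_simps
        power2_eq_square power3_eq_cube)
  have n: "real_of_int n = 5 * s * V ^ 3"
    by (simp add: n_def s_def U V_def[symmetric] U_def[symmetric] algebra_simps
        power2_eq_square power3_eq_cube)
  have V3: "V ^ 3 > 0" using V by simp
  have n0: "real_of_int n > 0" unfolding n using V3 s by simp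
  define q where "q = nat n"
  have qn: "real q = of_int n" using n0 by (simp add: q_def)
  have q0: "real q > 0" using n0 qn by simp
  define f where "f x = 10 * (3 * U - 5 * V) * x ^ 3 - 30 * V * x - (3 * U + V)" for x :: real
  \<comment> \<open>The divided difference is at least 17V * 3.6 - 30V = 31.2V.\<close>
  have growth: "30 * V * \<bar>x - y\<bar> \<le> \<bar>f x - f y\<bar>" if "x \<le> - 11 / 10" "y \<le> - 11 / 10" for x y
  proof -
    have "f x - f y = (10 * (3 * U - 5 * V) * (x\<^sup>2 + x * y + y\<^sup>2) - 30 * V) * (x - y)"
      by (simp add: f_def algebra_simps power2_eq_square power3_eq_cube)
    moreover have "30 * V \<le> 10 * (3 * U - 5 * V) * (x\<^sup>2 + x * y + y\<^sup>2) - 30 * V"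
    proof -
      have a: "(11 / 10) * (11 / 10) \<le> (- w) * (- z)" if "w \<le> - 11 / 10" "z \<le> - 11 / 10" for w z :: real
        using that by (intro mult_mono) auto
      have "36 / 10 \<le> x\<^sup>2 + x * y + y\<^sup>2"
        using a[of x x] a[of x y] a[of y y] that by (simp add: power2_eq_square)
      moreover have "17 * V \<le> 10 * (3 * U - 5 * V)"
        using mult_right_mono[OF rl, of V] V by (simp add: U)
      ultimately have "(17 * V) * (36 / 10) \<le> 10 * (3 * U - 5 * V) * (x\<^sup>2 + x * y + y\<^sup>2)"
        using V by - (rule mult_mono, linarith+)
      then show ?thesis using V by linarith
    qed
    ultimately show ?thesis using V by (simp add: abs_mult mult_right_mono)
  qed
  \<comment> \<open>The interval is chosen to give a sign change inside the half-line where
    \<open>growth\<close> holds; p/q, about -1.17, lies in that half-line too.\<close>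
  have f_ends: "100 * f (- 13 / 10) = 14785 * V - 6891 * U"
    "1000 * f (- 11 / 10) = 98550 * V - 42930 * U"
    by (simp_all add: f_def power3_eq_cube field_simps)
  have UV_ratio: "2236 * V \<le> 1000 * U" "1000 * U \<le> 2237 * V"
    using mult_right_mono[OF rl, of V] mult_right_mono[OF ru, of V] V by (simp_all add: U)
  have "f (- 13 / 10) \<le> 0" using V UV_ratio f_ends by linarith
  moreover have "0 \<le> f (- 11 / 10)" using V UV_ratio f_ends by linarith
  moreover have "continuous_on {- 13 / 10..- 11 / 10} f"
    unfolding f_def by (intro continuous_intros)
  ultimately obtain \<xi> where \<xi>: "\<xi> \<le> - 11 / 10" "f \<xi> = 0"
    using IVT'[of f "- 13 / 10" 0 "- 11 / 10"] by auto
  define x where "x = of_int p / real q"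
  have x: "x \<le> - 11 / 10"
    unfolding x_def qn p n using V3 s t by (simp add: field_simps)
  have px: "of_int p = x * real q" using q0 by (simp add: x_def)
  have "10 * (3 * U - 5 * V) * of_int p ^ 3 - 30 * V * of_int p * real q ^ 2 - (3 * U + V) * real q ^ 3
      = - 135 * (U\<^sup>2 - 5 * V\<^sup>2) ^ 5"
    using pell_cubic_identity[of U V] unfolding qn by (simp add: p_def n_def U_def V_def)
  then have "f x * real q ^ 3 = - 135"
    unfolding px UV f_def by (simp add: algebra_simps power2_eq_square power3_eq_cube)
  then have "\<bar>f x\<bar> * real q ^ 3 = 135"
    using q0 by (metis abs_minus_cancel abs_mult abs_numeral abs_of_pos zero_less_power)
  moreover have "30 * V * \<bar>\<xi> - x\<bar> \<le> \<bar>f x\<bar>" using growth[OF \<xi>(1) x] \<xi>(2) by simp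
  ultimately have "30 * V * \<bar>\<xi> - x\<bar> * real q ^ 3 \<le> 135"
    using mult_right_mono[of "30 * V * \<bar>\<xi> - x\<bar>" "\<bar>f x\<bar>" "real q ^ 3"] q0 by simp
  moreover have "30 * V * \<bar>\<xi> - x\<bar> * real q ^ 2 * (18 * V ^ 3)
      \<le> 30 * V * \<bar>\<xi> - x\<bar> * real q ^ 2 * real q"
  proof (rule mult_left_mono)
    show "18 * V ^ 3 \<le> real q" unfolding qn n using s V3 by simp
  qed (use V in simp)
  \<comment> \<open>Here 540 = 30 * 18, and 540 / 135 is the 4 of the claim.\<close>
  ultimately have "540 * (V ^ 4 * \<bar>\<xi> - x\<bar> * real q ^ 2) \<le> 135"
    by (simp add: power2_eq_square power3_eq_cube power4_eq_xxxx mult_ac)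
  moreover have "real q * \<bar>real q * \<xi> - of_int p\<bar> = \<bar>\<xi> - x\<bar> * real q ^ 2"
  proof -
    have "real q * \<xi> - of_int p = real q * (\<xi> - x)" unfolding px by (simp add: algebra_simps)
    then show ?thesis using q0 by (simp add: abs_mult power2_eq_square)
  qed
  ultimately have "real q * \<bar>real q * \<xi> - of_int p\<bar> * (4 * V ^ 4) \<le> 1"
    by (simp add: mult_ac)
  moreover have "real q \<le> 30 * V ^ 3" unfolding qn n using s V3 by simp
  moreover have "q \<ge> 1" using q0 by simp
  ultimately show thesis
    using that[of \<xi> q p] \<xi> by (simp add: f_def U_def V_def)
qed

text \<open>From 2v \<le> u \<le> 8v/3 the leading coefficient lies between 10v and 30v, and the
  constant term is at most 9v in absolute value, so 30v dominates.\<close>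

lemma pell_cubic_irrational:
  fixes u v :: int and \<xi> :: real
  assumes pell: "u\<^sup>2 - 5 * v\<^sup>2 = 1" and "u > 0" "v > 0"
    and root: "10 * (3 * of_int u - 5 * of_int v) * \<xi> ^ 3 - 30 * of_int v * \<xi> - (3 * of_int u + of_int v) = 0"
  shows "cubic_irrational \<xi>" and "1 \<le> naive_height \<xi>" and "naive_height \<xi> \<le> 30 * v"
proof -
  define F where "F = [:- (3 * u + v), - 30 * v, 0, 10 * (3 * u - 5 * v):]"
  have "poly (map_poly of_int F) \<xi> = 0"
    using root by (simp add: F_def map_poly_pCons algebra_simps power3_eq_cube)
  moreover have "odd (- (3 * u + v))" "even (- 30 * v)" "even (10 * (3 * u - 5 * v))"
    "\<not> 4 dvd 10 * (3 * u - 5 * v)"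
    using pell_parity[OF pell] by (auto elim!: oddE evenE) presburger+
  moreover have "3 * u \<le> 8 * v"
  proof (rule power2_le_imp_le)
    have "v\<^sup>2 > 0" using \<open>v > 0\<close> by simp
    then have "9 * u\<^sup>2 \<le> 64 * v\<^sup>2" using pell by linarith
    then show "(3 * u)\<^sup>2 \<le> (8 * v)\<^sup>2" by (simp add: power_mult_distrib)
  qed (use \<open>v > 0\<close> in simp)
  moreover have "2 * v \<le> u"
  proof (rule power2_le_imp_le)
    have "v\<^sup>2 \<ge> 0" by simp
    then have "4 * v\<^sup>2 \<le> u\<^sup>2" using pell by linarith
    then show "(2 * v)\<^sup>2 \<le> u\<^sup>2" by (simp add: power_mult_distrib)
  qed (use \<open>u > 0\<close> in simp)
  ultimately show "cubic_irrational \<xi>" "1 \<le> naive_height \<xi>" "naive_height \<xi> \<le> 30 * v"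
    using assms cubic_irrationalI[OF F_def, of \<xi>]
    by (auto simp: F_def coeff_pCons split: nat.splits)
qed

text \<open>This makes roots from different Pell solutions distinct, which yields infinitely many
  \<xi>. Negativity of \<xi> keeps the coefficient \<open>a\<close> of \<open>u\<close>
  nonzero.\<close>

lemma pell_cubic_root_unique:
  fixes u v u' v' :: int and \<xi> :: real
  assumes pell: "u\<^sup>2 - 5 * v\<^sup>2 = 1" "u'\<^sup>2 - 5 * v'\<^sup>2 = 1" and "v > 0" "v' > 0"
    and "10 * (3 * of_int u - 5 * of_int v) * \<xi> ^ 3 - 30 * of_int v * \<xi> - (3 * of_int u + of_int v) = 0"
    and "10 * (3 * of_int u' - 5 * of_int v') * \<xi> ^ 3 - 30 * of_int v' * \<xi> - (3 * of_int u' + of_int v') = 0"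
    and "\<xi> < 0"
  shows "v = v'"
proof -
  define a b where "a = 30 * \<xi> ^ 3 - 3" and "b = 50 * \<xi> ^ 3 + 30 * \<xi> + 1"
  have "\<xi> ^ 3 < 0" using \<open>\<xi> < 0\<close> by (simp add: power_less_zero_eq)
  then have "a \<noteq> 0" unfolding a_def by linarith
  txt \<open>The equation is linear in \<open>(u, v)\<close>, so \<open>\<xi>\<close> determines the ratio \<open>u / v\<close>.\<close>
  have "of_int u * a = of_int v * b" "of_int u' * a = of_int v' * b"
    using assms(5,6) by (simp_all add: a_def b_def algebra_simps)
  then have "(of_int u * of_int v') * a = (of_int u' * of_int v) * a"
    by (metis mult.commute mult.left_commute)
  then have "real_of_int u * of_int v' = of_int u' * of_int v" using \<open>a \<noteq> 0\<close> by simp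
  then have "of_int (u * v') = (of_int (u' * v) :: real)" by simp
  then have e: "u * v' = u' * v" by (simp only: of_int_eq_iff)
  \<comment> \<open>Each Pell equation is multiplied by the square of the other \<open>v\<close>;
    equal ratios make the right-hand sides agree.\<close>
  have "v'\<^sup>2 = (u * v')\<^sup>2 - 5 * v\<^sup>2 * v'\<^sup>2"
    using arg_cong[OF pell(1), of "\<lambda>z. z * v'\<^sup>2"] by (simp add: algebra_simps power_mult_distrib)
  moreover have "v\<^sup>2 = (u' * v)\<^sup>2 - 5 * v\<^sup>2 * v'\<^sup>2"
    using arg_cong[OF pell(2), of "\<lambda>z. z * v\<^sup>2"] by (simp add: algebra_simps power_mult_distrib)
  ultimately have "v\<^sup>2 = v'\<^sup>2" using e by simp
  then show ?thesis using \<open>v > 0\<close> \<open>v' > 0\<close> by simp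
qed

section \<open>Multiples of a good denominator\<close>

text \<open>Passing from q to kq multiplies q |q\<xi> - p| by k^2 at most. The hypothesis
  \<open>large\<close> collects the worst cases of all losses: k = N + 1, height 30V, exponent 15/4,
  and denominator 30(N + 1)V^3.\<close>

lemma multiples_of_good_denominator:
  fixes \<xi> \<tau> V :: real and N q :: nat and p :: int
  assumes "V \<ge> 1" and q: "q \<ge> 1" "real q \<le> 30 * V ^ 3"
    and approx: "real q * \<bar>real q * \<xi> - of_int p\<bar> * (4 * V ^ 4) \<le> 1"
    and H: "1 \<le> H" "H \<le> 30 * V" and "\<tau> \<le> 15 / 4"
    and large: "(real (Suc N))\<^sup>2 * (30 * V) powr (15 / 4)
        * exp (sqrt (ln (30 * real (Suc N) * V ^ 3))) < 4 * V ^ 4"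
    and k: "k \<in> {1..Suc N}"
  shows "dist_nearest_int (real (k * q) * \<xi>)
    < 1 / (H powr \<tau> * real (k * q) * exp (1 * sqrt (ln (real (k * q)))))"
proof -
  define A where "A = real q * \<bar>real q * \<xi> - of_int p\<bar>"
  define E where "E = exp (sqrt (ln (real (k * q))))"
  define E' where "E' = exp (sqrt (ln (30 * real (Suc N) * V ^ 3)))"
  have kq: "real (k * q) \<ge> 1" using k q by (subst of_nat_1[symmetric], subst of_nat_le_iff) simp
  have "real (k * q) \<le> real (Suc N) * (30 * V ^ 3)"
    using k q unfolding of_nat_mult by (intro mult_mono) auto
  then have "real (k * q) \<le> 30 * real (Suc N) * V ^ 3" by (simp only: mult_ac)
  then have "E \<le> E'" unfolding E_def E'_def
    using kq by (intro iffD2[OF exp_le_cancel_iff] real_sqrt_le_mono ln_mono) linarith+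
  have Hp: "H powr \<tau> \<le> (30 * V) powr (15 / 4)"
    using H \<open>\<tau> \<le> 15 / 4\<close> powr_mono[of \<tau> "15 / 4" H] powr_mono2[of "15 / 4" H "30 * V"] by simp
  have "A \<ge> 0" "E \<ge> 0" "E' \<ge> 0" by (simp_all add: A_def E_def E'_def)
  have V4: "V ^ 4 > 0" using \<open>V \<ge> 1\<close> by simp
  have "dist_nearest_int (real (k * q) * \<xi>) \<le> \<bar>real (k * q) * \<xi> - of_int (int k * p)\<bar>"
    unfolding dist_nearest_int_def by (rule round_diff_minimal)
  also have "real (k * q) * \<xi> - of_int (int k * p) = real k * (real q * \<xi> - of_int p)"
    by (simp add: algebra_simps)
  finally have "dist_nearest_int (real (k * q) * \<xi>) * (H powr \<tau> * real (k * q) * E)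
      \<le> real k * \<bar>real q * \<xi> - of_int p\<bar> * (H powr \<tau> * real (k * q) * E)"
    using kq by (intro mult_right_mono) (auto simp: abs_mult E_def)
  also have "\<dots> = (real k)\<^sup>2 * (H powr \<tau>) * E * A"
    by (simp add: A_def power2_eq_square)
  also have "\<dots> \<le> (real (Suc N))\<^sup>2 * (30 * V) powr (15 / 4) * E' * A"
    using k Hp \<open>E \<le> E'\<close> \<open>A \<ge> 0\<close> \<open>E \<ge> 0\<close> \<open>E' \<ge> 0\<close>
    by (intro mult_mono power_mono) auto
  also have "\<dots> < 1"
  \<comment> \<open>The strict inequality \<open>large\<close> can be multiplied by \<open>A\<close>
    only if \<open>A\<close> is positive.\<close>
  proof (cases "A = 0")
    case False
    then have "(real (Suc N))\<^sup>2 * (30 * V) powr (15 / 4) * E' * A < 4 * V ^ 4 * A"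
      using large \<open>A \<ge> 0\<close> unfolding E'_def by (intro mult_strict_right_mono) auto
    also have "\<dots> \<le> 1" using approx by (simp add: A_def mult_ac)
    finally show ?thesis .
  qed simp
  finally have "dist_nearest_int (real (k * q) * \<xi>) * (H powr \<tau> * real (k * q) * E) < 1" .
  moreover have "H powr \<tau> * real (k * q) * E > 0" using H kq by (simp add: E_def)
  ultimately show ?thesis by (simp only: pos_less_divide_eq E_def mult_1)
qed

section \<open>Computability of the constant\<close>

text \<open>The program doubles its input without consulting the oracle. Since 2n encodes the
  integer n, it names 1 by the fractions n/(n + 1), whose error is exactly the permitted 1/(n +
  1).\<close>

lemma computes_real_one:
  "computes_real (PrimRec Zero (Comp Succ [Comp Succ [Proj 1]])) t 1"
proof -
  have step: "computes \<phi> (Comp Succ [Comp Succ [Proj 1]]) [n, y] (Suc (Suc y))" for \<phi> n y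
    using computes.proj[of 1 "[n, y]" \<phi>]
    by (intro computes.comp[where ys = "[Suc y]"] computes.comp[where ys = "[y]"])
      (auto intro!: computes.comp[where ys = "[y]"] computes.succ)
  have "computes \<phi> (PrimRec Zero (Comp Succ [Comp Succ [Proj 1]])) [n] (2 * n)" for \<phi> n
  proof (induction n)
    case 0
    show ?case by (auto intro: computes.intros)
  next
    case (Suc n)
    from computes.prec_Suc[OF this step] show ?case by simp
  qed
  moreover have "is_name (\<lambda>n. 2 * n) 1"
  proof -
    have "int_decode (2 * n) = int n" for n
      by (simp add: int_decode_def sum_decode_def)
    then show ?thesis by (simp add: is_name_def field_simps)
  qed
  ultimately show ?thesis unfolding computes_real_def by blast
qed

section \<open>Infinitely many cubics from large Pell solutions\<close>

theorem theorem2: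
  shows "\<exists>p::recf. \<forall>\<tau>::real. \<tau> < 3 + 15 * ln 2 / 24 \<longrightarrow>
    (\<exists>c::real. c > 0 \<and> computes_real p \<tau> c \<and>
      (\<forall>N0::nat. infinite {\<xi>::real. cubic_irrational \<xi> \<and>
        (let S = {q::nat. q \<ge> 1 \<and>
               dist_nearest_int (real q * \<xi>)
                 < 1 / (real_of_int (naive_height \<xi>) powr \<tau> * real q * exp (c * sqrt (ln (real q))))}
         in infinite S \<or> card S > N0)}))"
proof (intro exI allI impI conjI)
  fix \<tau> :: real and N :: nat
  assume "\<tau> < 3 + 15 * ln 2 / 24"
  \<comment> \<open>As ln 2 \<le> 1, \<tau> is below 3.625; 15/4 is a convenient exponent below 4,
    leaving a power V^(1/4) to absorb the other factors.\<close>
  then have \<tau>: "\<tau> \<le> 15 / 4" using ln_le_minus_one[of 2] by simp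
  define K where "K = real (Suc N)"
  have "K > 0" by (simp add: K_def)
  then have "eventually (\<lambda>V::real. K\<^sup>2 * (30 * V) powr (15 / 4)
      * exp (sqrt (ln (30 * K * V ^ 3))) < 4 * V ^ 4) at_top"
    by real_asymp
  then obtain V0 where V0: "\<And>V. V \<ge> V0 \<Longrightarrow>
      K\<^sup>2 * (30 * V) powr (15 / 4) * exp (sqrt (ln (30 * K * V ^ 3))) < 4 * V ^ 4"
    by (auto simp: eventually_at_top_linorder)
  \<comment> \<open>The factor \<open>1 *\<close> keeps the shape of the goal with \<open>c\<close>
    instantiated to 1.\<close>
  define S where "S \<xi> = {q::nat. q \<ge> 1 \<and> dist_nearest_int (real q * \<xi>)
      < 1 / (real_of_int (naive_height \<xi>) powr \<tau> * real q * exp (1 * sqrt (ln (real q))))}" for \<xi>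
  define Good where "Good = {\<xi>. cubic_irrational \<xi> \<and> (infinite (S \<xi>) \<or> card (S \<xi>) > N)}"
  define rooted where "rooted \<xi> v \<longleftrightarrow> \<xi> < 0 \<and> v > 0 \<and> (\<exists>u. u\<^sup>2 - 5 * v\<^sup>2 = 1 \<and>
      10 * (3 * of_int u - 5 * of_int v) * \<xi> ^ 3 - 30 * of_int v * \<xi> - (3 * of_int u + of_int v) = 0)"
    for \<xi> :: real and v :: int
  have unique: "v = v'" if "rooted \<xi> v" "rooted \<xi> v'" for \<xi> v v'
    using that pell_cubic_root_unique unfolding rooted_def by blast
  have good: "\<exists>v \<xi>. v > int n \<and> rooted \<xi> v \<and> \<xi> \<in> Good" for n
  proof -
    obtain u v :: int where pell: "u\<^sup>2 - 5 * v\<^sup>2 = 1" "u > 0"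
      \<comment> \<open>The three bounds serve unboundedness of \<open>v\<close>, the approximation
        lemma and the asymptotic estimate.\<close>
      and v: "v > int (max n (max 16 (nat \<lceil>V0\<rceil>)))"
      using pell_solution_above by blast
    then have v16: "v \<ge> 16" and vV0: "V0 \<le> of_int v" by linarith+
    obtain \<xi> :: real and p :: int and q :: nat where
      root: "10 * (3 * of_int u - 5 * of_int v) * \<xi> ^ 3 - 30 * of_int v * \<xi> - (3 * of_int u + of_int v) = 0"
      and "\<xi> < 0" and q: "q \<ge> 1" "real q \<le> 30 * of_int v ^ 3"
      and approx: "real q * \<bar>real q * \<xi> - of_int p\<bar> * (4 * of_int v ^ 4) \<le> 1"
      using pell_cubic_approximation[OF pell v16] by blast
    have "v > 0" using v16 by simp
    note cubic = pell_cubic_irrational[OF pell \<open>v > 0\<close> root]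
    have "1 \<le> real_of_int (naive_height \<xi>)" "real_of_int (naive_height \<xi>) \<le> 30 * of_int v"
      using cubic(2,3) by linarith+
    then have "(\<lambda>k. k * q) ` {1..Suc N} \<subseteq> S \<xi>"
      using multiples_of_good_denominator[OF _ q approx _ _ \<tau>, of "real_of_int (naive_height \<xi>)" N]
        V0[OF vV0] v16 q(1) unfolding S_def K_def by (auto simp: Suc_le_eq)
    then have "finite (S \<xi>) \<Longrightarrow> card ((\<lambda>k. k * q) ` {1..Suc N}) \<le> card (S \<xi>)"
      by (rule card_mono[rotated])
    moreover have "card ((\<lambda>k. k * q) ` {1..Suc N}) = Suc N"
      using q by (subst card_image) (auto simp: inj_on_def)
    ultimately have "\<xi> \<in> Good" unfolding Good_def using cubic(1) by auto
    moreover have "rooted \<xi> v"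
      unfolding rooted_def using pell root \<open>\<xi> < 0\<close> \<open>v > 0\<close> by blast
    moreover have "v > int n" using v by simp
    ultimately show ?thesis by blast
  qed
  have "infinite Good"
  proof
    assume "finite Good"
    \<comment> \<open>By uniqueness \<open>v\<close> is a function of \<xi>, so finitely many \<xi>
      would bound \<open>v\<close>, against \<open>good\<close>.\<close>
    moreover have "{v. \<exists>\<xi>\<in>Good. rooted \<xi> v} \<subseteq> (\<lambda>\<xi>. THE v. rooted \<xi> v) ` Good"
      using unique by (auto intro!: image_eqI the_equality[symmetric])
    ultimately have "finite {v. \<exists>\<xi>\<in>Good. rooted \<xi> v}" using finite_surj by blast
    then obtain m where "\<And>v. v \<in> {v. \<exists>\<xi>\<in>Good. rooted \<xi> v} \<Longrightarrow> v \<le> m"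
      using bdd_above_finite by (fastforce simp: bdd_above_def)
    moreover obtain v \<xi> where "v > int (nat m)" "rooted \<xi> v" "\<xi> \<in> Good" using good by blast
    ultimately have "v \<le> m" "v > int (nat m)" by blast+
    then show False by linarith
  qed
  then show "infinite {\<xi>. cubic_irrational \<xi> \<and>
      (let S = {q::nat. q \<ge> 1 \<and> dist_nearest_int (real q * \<xi>)
         < 1 / (real_of_int (naive_height \<xi>) powr \<tau> * real q * exp (1 * sqrt (ln (real q))))}
       in infinite S \<or> card S > N)}"
    unfolding Good_def S_def Let_def .
qed (rule zero_less_one computes_real_one)+

end
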